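(* Let $g\ge3$ and $a_1\ge a_2\ge1$ be integers, and suppose the unicyclic graph $U_g^{a_1,a_2}$ has order $n=g+a_1+a_2=q^2+r$ with integers $q\ge1$ and $1\le r\le 2q+1$. Suppose that at least one of the following holds: (1) $r\ge 2q-1$; (2) $3\le g\le r$; (3) $g\ge q^2+1$; (4) $a_1\ge q^2-\lfloor\frac g2\rfloor$; (5) $2q\le g\le q^2$ and $a_2\le r-q$; (6) $(g,a_1,a_2)\in\bigcup_{i=1}^6\mathcal C_i\cup\mathcal B$. Then $b(U_g^{a_1,a_2})=\lceil\sqrt n\,\rceil=q+1$.
   Context: All graphs are finite and simple. Burning number: at time $0$ all vertices of $G$ are unburned. In each round $t\ge1$, one new unburned vertex is chosen to burn (if such a vertex exists), and every unburned neighbour of a vertex that was burned by the end of the previous round becomes burned; burned vertices stay burned. The process ends when all vertices are burned. $b(G)$ is the smallest $k$ such that $G$ can be completely burned within $k$ rounds by a suitable choice of vertices. $U_g^{a_1,a_2}$ (with $a_1\ge a_2\ge 1$) is the unicyclic graph of order $n=g+a_1+a_2$ obtained from a cycle $C_g=v_1v_2\cdots v_gv_1$ by attaching two paths at $v_g$, contributing $a_1$ and $a_2$ new vertices respectively, one end of each being adjacent to $v_g$. The following sets of triples depend on $q$ and $r$ (where $n=q^2+r$). $\mathcal B=\{(2q-2,q^2-q-2,q+1),(2q-1,q^2-q-2,q+1)\}$. $B_1=\{(q^2-2,q,q),(q^2-6,q+2,q+2),(q^2-10,q+4,q+4),(q^2-3,q+1,q),(q^2-5,q+3,q),(q^2-7,q+3,q+2),(q^2-8,q+3,q+3),(q^2-7,q+5,q),(q^2-10,q+5,q+3),(q^2-11,q+5,q+4),(q^2-12,q+5,q+5),(q^2-14,q+6,q+6),(q^2-12,q+7,q+3),(q^2-14,q+7,q+5),(q^2-14,q+9,q+3)\}$.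 $B_2=\{(2q,q^2-q-2,q),(2q+2,q^2-q-6,q+2),(2q+4,q^2-q-10,q+4),(2q+1,q^2-q-3,q),(2q+3,q^2-q-5,q),(2q+3,q^2-q-7,q+2),(2q+3,q^2-q-8,q+3),(2q+5,q^2-q-7,q),(2q+5,q^2-q-10,q+3),(2q+5,q^2-q-11,q+4),(2q+5,q^2-q-12,q+5),(2q+6,q^2-q-14,q+6),(2q+7,q^2-q-12,q+3),(2q+7,q^2-q-14,q+5),(2q+9,q^2-q-14,q+3)\}$. $B_3=\{(2q,q^2-q-3,q+1),(2q,q^2-q-5,q+3),(2q+2,q^2-q-7,q+3),(2q,q^2-q-7,q+5),(2q+3,q^2-q-10,q+5),(2q+4,q^2-q-11,q+5),(2q+3,q^2-q-12,q+7),(2q+5,q^2-q-14,q+7),(2q+3,q^2-q-14,q+9)\}$. $B_4=\{(24,16,6),(22,16,8),(35,19,7),(32,19,10),(30,19,12),(28,19,14),(26,19,16),(30,21,10),(28,21,12),(45,22,11),(43,22,13),(41,22,15),(34,22,22),(43,24,11),(41,24,13),(32,24,22),(41,26,11),(60,25,12),(58,25,14),(47,25,25),(58,27,12),(47,38,12),(77,28,13)\}$. $B_5=\{(22,18,6),(22,16,8),(26,28,7),(26,25,10),(26,23,12),(26,21,14),(26,19,16),(28,23,10),(28,21,12),(30,37,11),(30,35,13),(30,33,15),(30,26,22),(32,35,11),(32,33,13),(32,24,22),(34,33,11),(34,51,12),(34,49,14),(34,38,25),(36,49,12),(47,38,12),(38,67,13)\}$. $B_6=\{(12,18,16),(14,16,16),(14,28,19),(17,25,19),(19,23,19),(21,21,19),(23,19,19),(17,23,21),(19,21,21),(19,37,22),(21,35,22),(23,33,22),(30,26,22),(19,35,24),(21,33,24),(30,24,24),(19,33,26),(21,51,25),(23,49,25),(34,38,25),(21,49,27),(21,38,38),(23,67,28)\}$.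 $\mathcal C_1=\{(2q+1,q^2-q-2,r-q+1),(q^2-2,q+1,r-q+1)\}$. $\mathcal C_2=\{(q^2-7,q+2,q+1),(2q+1,q^2-q-6,q+1),(2q+1,q^2-q-7,q+2)\}$. $\mathcal C_3=\{(q^2-3,q,q),(q^2-5,q+1,q+1),(q^2-6,q+2,q+1),(q^2-7,q+2,q+2),(q^2-7,q+3,q+1),(q^2-11,q+4,q+4),(2q+4,q^2-q-11,q+4),(2q+1,q^2-q-5,q+1),(2q+1,q^2-q-6,q+2),(2q+1,q^2-q-7,q+3),(2q+2,q^2-q-6,q+1),(2q+2,q^2-q-7,q+2),(2q+3,q^2-q-7,q+1),(2q,q^2-q-3,q),(22,16,7),(13,16,16)\}$. $\mathcal C_4=\{(g,a_1,a_2): n=q^2+2q-2,\ g-q\ge a_1\ge a_2=q+1\}\cup B_1\cup B_4$. $\mathcal C_5=\{(g,a_1,a_2): n=q^2+2q-2,\ a_1\ge g-q\ge a_2=q+1\}\cup B_2\cup B_5$. $\mathcal C_6=\{(g,a_1,a_2): n=q^2+2q-2,\ a_1\ge a_2\ge g-q=q+1\}\cup B_3\cup B_6$. In $\mathcal C_4,\mathcal C_5,\mathcal C_6$, $n=g+a_1+a_2$. *)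

theory Defs
  imports Complex_Main "Graph_Theory.Graph_Theory"
begin

text \<open>
  Finite simple graphs are those \<open>G :: 'a pair_pre_digraph\<close> that satisfy \<open>pair_graph G\<close>: an
  undirected edge is represented by its two arcs, and \<open>parcs G `` S\<close> is the set of all
  neighbours of vertices in \<open>S\<close>.
\<close>

text \<open>
  \<open>burning_round G B B'\<close>: if \<open>B\<close> is the set of vertices burned by the end of a round, then \<open>B'\<close>
  may be the set of vertices burned by the end of the next one.  The chosen vertex has to be
  unburned at the beginning of the round; it may be a vertex which the spreading fire would
  reach in this very round.  The first disjunct is the case in which no vertex can be chosen.
\<close>

definition burning_round :: "'a pair_pre_digraph \<Rightarrow> 'a set \<Rightarrow> 'a set \<Rightarrow> bool" where
  "burning_round G B B' \<longleftrightarrow>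
     (pverts G \<subseteq> B \<and> B' = B \<union> parcs G `` B) \<or>
     (\<exists>x \<in> pverts G - B. B' = insert x (B \<union> parcs G `` B))"

definition burnable_within :: "'a pair_pre_digraph \<Rightarrow> nat \<Rightarrow> bool" where
  "burnable_within G k \<longleftrightarrow>
     (\<exists>B :: nat \<Rightarrow> 'a set. B 0 = {} \<and> (\<forall>t<k. burning_round G (B t) (B (Suc t))) \<and> B k = pverts G)"

definition burning_number :: "'a pair_pre_digraph \<Rightarrow> nat" where
  "burning_number G = (LEAST k. burnable_within G k)"

text \<open>The minimum defining the burning number is attained for every finite simple graph.\<close>

lemma (in pair_graph) burnable_within_ex: "\<exists>k. burnable_within G k"
proof -
  define step where "step B = (if pverts G \<subseteq> B then B \<union> parcs G `` B
    else insert (SOME x. x \<in> pverts G - B) (B \<union> parcs G `` B))" for B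
  define S where "S t = (step ^^ t) {}" for t
  have S0: "S 0 = {}" and SSuc: "S (Suc t) = step (S t)" for t
    by (simp_all add: S_def)
  have some: "(SOME x. x \<in> pverts G - B) \<in> pverts G - B" if "\<not> pverts G \<subseteq> B" for B
    using that by (intro someI_ex[of "\<lambda>x. x \<in> pverts G - B"]) blast
  have round: "burning_round G B (step B)" for B
    using some[of B] unfolding burning_round_def step_def by auto
  have arcs: "parcs G `` B \<subseteq> pverts G" for B
    by (auto dest: in_arcsD2)
  have sub: "S t \<subseteq> pverts G" for t
  proof (induction t)
    case (Suc t)
    then show ?case using arcs[of "S t"] some[of "S t"] by (auto simp: SSuc step_def)
  qed (simp add: S0)
  have grow: "S t = pverts G \<or> t \<le> card (S t)" for t
  proof (induction t)
    case (Suc t)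
    show ?case
    proof (cases "pverts G \<subseteq> S t")
      case True
      then show ?thesis using sub[of t] arcs[of "S t"] by (auto simp: SSuc step_def)
    next
      case False
      then have "insert (SOME x. x \<in> pverts G - S t) (S t) \<subseteq> S (Suc t)"
        by (auto simp: SSuc step_def)
      then have "S t \<subset> S (Suc t)" using some[OF False] by blast
      then have "card (S t) < card (S (Suc t))"
        using sub[of "Suc t"] pair_finite_verts by (meson finite_subset psubset_card_mono)
      then show ?thesis using Suc.IH False by auto
    qed
  qed simp
  have "S (Suc (card (pverts G))) = pverts G"
    using grow[of "Suc (card (pverts G))"] card_mono[OF pair_finite_verts sub]
    by (metis not_less_eq_eq)
  then have "burnable_within G (Suc (card (pverts G)))"
    unfolding burnable_within_def by (intro exI[of _ S]) (simp add: S0 SSuc round)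
  then show ?thesis by blast
qed


text \<open>
  In \<open>unicyclic2 g a\<^sub>1 a\<^sub>2\<close>, \<open>Cyc i\<close> with \<open>1 \<le> i \<le> g\<close> is the vertex \<open>v\<^sub>i\<close> of the cycle, and
  \<open>Arm1 i\<close>, \<open>Arm2 i\<close> are the vertices at distance \<open>i\<close> from \<open>v\<^sub>g\<close> on the two attached paths.  The
  definition is meaningful for \<open>g \<ge> 3\<close> and \<open>a\<^sub>1, a\<^sub>2 \<ge> 1\<close>.
\<close>

datatype uvertex = Cyc nat | Arm1 nat | Arm2 nat

definition unicyclic2_edges :: "nat \<Rightarrow> nat \<Rightarrow> nat \<Rightarrow> uvertex rel" where
  "unicyclic2_edges g a1 a2 =
     {(Cyc i, Cyc (Suc i)) | i. 1 \<le> i \<and> i < g} \<union> {(Cyc g, Cyc 1)} \<union>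
     {(Cyc g, Arm1 1)} \<union> {(Arm1 i, Arm1 (Suc i)) | i. 1 \<le> i \<and> i < a1} \<union>
     {(Cyc g, Arm2 1)} \<union> {(Arm2 i, Arm2 (Suc i)) | i. 1 \<le> i \<and> i < a2}"

definition unicyclic2 :: "nat \<Rightarrow> nat \<Rightarrow> nat \<Rightarrow> uvertex pair_pre_digraph" where
  "unicyclic2 g a1 a2 =
     \<lparr> pverts = Cyc ` {1..g} \<union> Arm1 ` {1..a1} \<union> Arm2 ` {1..a2},
       parcs = unicyclic2_edges g a1 a2 \<union> (unicyclic2_edges g a1 a2)\<inverse> \<rparr>"

lemma card_pverts_unicyclic2: "card (pverts (unicyclic2 g a1 a2)) = g + a1 + a2"
proof -
  have "card (Cyc ` {1..g} \<union> Arm1 ` {1..a1} \<union> Arm2 ` {1..a2}) =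
      card (Cyc ` {1..g}) + card (Arm1 ` {1..a1}) + card (Arm2 ` {1..a2})"
    by (subst card_Un_disjoint; (subst card_Un_disjoint)?) auto
  then show ?thesis by (simp add: unicyclic2_def card_image inj_on_def)
qed

lemma pair_graph_unicyclic2:
  assumes "g \<ge> 3" "a1 \<ge> 1" "a2 \<ge> 1"
  shows "pair_graph (unicyclic2 g a1 a2)"
proof -
  let ?G = "unicyclic2 g a1 a2"
  have arcs: "fst e \<in> pverts ?G \<and> snd e \<in> pverts ?G \<and> fst e \<noteq> snd e" if "e \<in> parcs ?G" for e
    using that assms by (auto simp: unicyclic2_def unicyclic2_edges_def)
  have fin: "finite (pverts ?G)" by (simp add: unicyclic2_def)
  have "parcs ?G \<subseteq> pverts ?G \<times> pverts ?G"
  proof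
    fix e assume "e \<in> parcs ?G"
    from arcs[OF this] show "e \<in> pverts ?G \<times> pverts ?G" by (cases e) auto
  qed
  then have "finite (parcs ?G)" using fin by (meson finite_SigmaI finite_subset)
  moreover have "symmetric (with_proj ?G)"
    by (simp add: symmetric_def unicyclic2_def sym_Un_converse)
  ultimately show ?thesis using arcs fin by unfold_locales auto
qed


text \<open>The exceptional triples \<open>(g, a\<^sub>1, a\<^sub>2)\<close>; they are integers, so that subtraction is genuine.\<close>

definition excB :: "int \<Rightarrow> (int \<times> int \<times> int) set" where
  "excB q = {(2*q-2, q^2-q-2, q+1), (2*q-1, q^2-q-2, q+1)}"

definition excB1 :: "int \<Rightarrow> (int \<times> int \<times> int) set" where
  "excB1 q = {(q^2-2, q, q), (q^2-6, q+2, q+2), (q^2-10, q+4, q+4), (q^2-3, q+1, q),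
     (q^2-5, q+3, q), (q^2-7, q+3, q+2), (q^2-8, q+3, q+3), (q^2-7, q+5, q),
     (q^2-10, q+5, q+3), (q^2-11, q+5, q+4), (q^2-12, q+5, q+5), (q^2-14, q+6, q+6),
     (q^2-12, q+7, q+3), (q^2-14, q+7, q+5), (q^2-14, q+9, q+3)}"

definition excB2 :: "int \<Rightarrow> (int \<times> int \<times> int) set" where
  "excB2 q = {(2*q, q^2-q-2, q), (2*q+2, q^2-q-6, q+2), (2*q+4, q^2-q-10, q+4),
     (2*q+1, q^2-q-3, q), (2*q+3, q^2-q-5, q), (2*q+3, q^2-q-7, q+2),
     (2*q+3, q^2-q-8, q+3), (2*q+5, q^2-q-7, q), (2*q+5, q^2-q-10, q+3),
     (2*q+5, q^2-q-11, q+4), (2*q+5, q^2-q-12, q+5), (2*q+6, q^2-q-14, q+6),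
     (2*q+7, q^2-q-12, q+3), (2*q+7, q^2-q-14, q+5), (2*q+9, q^2-q-14, q+3)}"

definition excB3 :: "int \<Rightarrow> (int \<times> int \<times> int) set" where
  "excB3 q = {(2*q, q^2-q-3, q+1), (2*q, q^2-q-5, q+3), (2*q+2, q^2-q-7, q+3),
     (2*q, q^2-q-7, q+5), (2*q+3, q^2-q-10, q+5), (2*q+4, q^2-q-11, q+5),
     (2*q+3, q^2-q-12, q+7), (2*q+5, q^2-q-14, q+7), (2*q+3, q^2-q-14, q+9)}"

definition excB4 :: "(int \<times> int \<times> int) set" where
  "excB4 = {(24,16,6), (22,16,8), (35,19,7), (32,19,10), (30,19,12), (28,19,14), (26,19,16),
     (30,21,10), (28,21,12), (45,22,11), (43,22,13), (41,22,15), (34,22,22), (43,24,11),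
     (41,24,13), (32,24,22), (41,26,11), (60,25,12), (58,25,14), (47,25,25), (58,27,12),
     (47,38,12), (77,28,13)}"

definition excB5 :: "(int \<times> int \<times> int) set" where
  "excB5 = {(22,18,6), (22,16,8), (26,28,7), (26,25,10), (26,23,12), (26,21,14), (26,19,16),
     (28,23,10), (28,21,12), (30,37,11), (30,35,13), (30,33,15), (30,26,22), (32,35,11),
     (32,33,13), (32,24,22), (34,33,11), (34,51,12), (34,49,14), (34,38,25), (36,49,12),
     (47,38,12), (38,67,13)}"

definition excB6 :: "(int \<times> int \<times> int) set" where
  "excB6 = {(12,18,16), (14,16,16), (14,28,19), (17,25,19), (19,23,19), (21,21,19), (23,19,19),
     (17,23,21), (19,21,21), (19,37,22), (21,35,22), (23,33,22), (30,26,22), (19,35,24),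
     (21,33,24), (30,24,24), (19,33,26), (21,51,25), (23,49,25), (34,38,25), (21,49,27),
     (21,38,38), (23,67,28)}"

definition excC1 :: "int \<Rightarrow> int \<Rightarrow> (int \<times> int \<times> int) set" where
  "excC1 q r = {(2*q+1, q^2-q-2, r-q+1), (q^2-2, q+1, r-q+1)}"

definition excC2 :: "int \<Rightarrow> (int \<times> int \<times> int) set" where
  "excC2 q = {(q^2-7, q+2, q+1), (2*q+1, q^2-q-6, q+1), (2*q+1, q^2-q-7, q+2)}"

definition excC3 :: "int \<Rightarrow> (int \<times> int \<times> int) set" where
  "excC3 q = {(q^2-3, q, q), (q^2-5, q+1, q+1), (q^2-6, q+2, q+1), (q^2-7, q+2, q+2),
     (q^2-7, q+3, q+1), (q^2-11, q+4, q+4), (2*q+4, q^2-q-11, q+4), (2*q+1, q^2-q-5, q+1),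
     (2*q+1, q^2-q-6, q+2), (2*q+1, q^2-q-7, q+3), (2*q+2, q^2-q-6, q+1),
     (2*q+2, q^2-q-7, q+2), (2*q+3, q^2-q-7, q+1), (2*q, q^2-q-3, q), (22,16,7), (13,16,16)}"

definition excC4 :: "int \<Rightarrow> (int \<times> int \<times> int) set" where
  "excC4 q = {(g, a1, a2). g + a1 + a2 = q^2+2*q-2 \<and> g - q \<ge> a1 \<and> a1 \<ge> a2 \<and> a2 = q+1}
     \<union> excB1 q \<union> excB4"

definition excC5 :: "int \<Rightarrow> (int \<times> int \<times> int) set" where
  "excC5 q = {(g, a1, a2). g + a1 + a2 = q^2+2*q-2 \<and> a1 \<ge> g - q \<and> g - q \<ge> a2 \<and> a2 = q+1}
     \<union> excB2 q \<union> excB5"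

definition excC6 :: "int \<Rightarrow> (int \<times> int \<times> int) set" where
  "excC6 q = {(g, a1, a2). g + a1 + a2 = q^2+2*q-2 \<and> a1 \<ge> a2 \<and> a2 \<ge> g - q \<and> g - q = q+1}
     \<union> excB3 q \<union> excB6"

end

theory Submission
  imports Defs
begin

text \<open>
  A graph burns within \<open>k\<close> rounds if and only if it is covered by balls of radii
  \<open>0, 1, \<dots>, k - 1\<close> (\<open>burnable_within_of_cover\<close>, \<open>cover_of_burnable_within\<close>).  On a path, the
  ball of radius \<open>i\<close> is a block of at most \<open>2 * i + 1\<close> vertices, and the \<open>k\<close> blocks have at most
  \<open>k^2\<close> vertices together.

  \<^emph>\<open>Upper bound.\<close>  Without one of the two cycle edges at the vertex \<open>v\<^sub>g\<close> of degree four, the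
  hub, the graph is a spider with three legs.  As long as some leg is long, its outer end is cut
  off by the largest remaining block.  Once all legs are short, the largest ball is put at (or
  next to) the hub, and what remains of the legs fits into the next few blocks.  Hence a spider
  with at most \<open>k^2\<close> vertices burns within \<open>k\<close> rounds (\<open>spider_split_exists\<close>,
  \<open>burnable_of_spider_split\<close>), and \<open>n \<le> (q + 1)^2\<close>.

  \<^emph>\<open>Lower bound.\<close>  Only at the hub can a ball be larger than a block.  Among all balls of a cover
  only the one reaching deepest beyond the hub gains from this; every other one adds at most one
  block, on its own leg (\<open>fire_split_of_burnable\<close>).  If the deepest ball has its centre at
  distance \<open>d\<close> from the hub and covers everything up to distance \<open>s\<close> from the hub, then its gain
  over a block is at most \<open>2 * s\<close>.  So \<open>q\<close> rounds reach at most \<open>q^2 + 2 * s\<close> vertices, where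
  \<open>s + d \<le> q - 1\<close>, and fewer still if the cycle or an arm lies entirely within distance \<open>s\<close>.
  This excludes the first five conditions by counting.  In the exceptional triples, \<open>n\<close> is so
  close to the bound that the largest ball is forced to lie at the hub (in one family of triples,
  the ball at the hub may also be one size smaller, or the largest ball may lie next to the hub),
  and the remaining blocks must cover the rest of the three legs almost without excess.  These
  rests then have lengths that disjoint sets of odd numbers cannot provide, such as 2, or 1 and 4
  (\<open>no_fire_split\<close>).
\<close>

section \<open>Burning and covering by balls\<close>

text \<open>The closed ball of radius \<open>m\<close> around \<open>x\<close>: everything a fire lit at \<open>x\<close> reaches in \<open>m\<close> rounds.\<close>
primrec fire :: "'a pair_pre_digraph \<Rightarrow> 'a \<Rightarrow> nat \<Rightarrow> 'a set" where
  "fire G x 0 = {x}"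
| "fire G x (Suc m) = fire G x m \<union> parcs G `` fire G x m"

lemma fire_mono: "m \<le> m' \<Longrightarrow> fire G x m \<subseteq> fire G x m'"
  by (rule lift_Suc_mono_le[of "fire G x"]) auto

lemma fire_trans: "y \<in> fire G x l \<Longrightarrow> z \<in> fire G y m \<Longrightarrow> z \<in> fire G x (l + m)"
  by (induction m arbitrary: z) auto

lemma fire_le: "y \<in> fire G x l \<Longrightarrow> l \<le> m \<Longrightarrow> y \<in> fire G x m"
  using fire_mono[of l m G x] by auto

text \<open>
  The centre of the ball of radius \<open>i\<close> is lit in round \<open>k - i\<close>, so that its fire has \<open>i\<close> rounds left
  to spread.  If the centre is already burning in that round, any unburned vertex may be
  lit instead: the old fire is ahead of the intended one.
\<close>
lemma (in pair_graph) burnable_within_of_cover: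
  assumes c: "\<And>i. i < k \<Longrightarrow> c i \<in> pverts G"
    and cov: "pverts G \<subseteq> (\<Union>i<k. fire G (c i) i)"
  shows "burnable_within G k"
proof -
  define new where "new t B = (if c (k - 1 - t) \<in> B then SOME x. x \<in> pverts G - B else c (k - 1 - t))" for t B
  define step where "step t B = (if pverts G \<subseteq> B then B \<union> parcs G `` B
    else insert (new t B) (B \<union> parcs G `` B))" for t B
  define B where "B = rec_nat {} step"
  have B0: "B 0 = {}" and BSuc: "B (Suc t) = step t (B t)" for t
    by (simp_all add: B_def)
  have new: "new t X \<in> pverts G - X" if "\<not> pverts G \<subseteq> X" "t < k" for t X
    using that c[of "k - 1 - t"] someI_ex[of "\<lambda>x. x \<in> pverts G - X"]
    by (auto simp: new_def)
  have arcs: "parcs G `` X \<subseteq> pverts G" for X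
    by (auto dest: in_arcsD2)
  have inside: "B t \<subseteq> pverts G" if "t \<le> k" for t
    using that
  proof (induction t)
    case (Suc t)
    then show ?case using new[of "B t" t] arcs[of "B t"] by (auto simp: BSuc step_def)
  qed (simp add: B0)
  have spread: "fire G (c i) (t + i - k) \<subseteq> B t" if "i < k" "k \<le> t + i" "t \<le> k" for i t
    using that
  proof (induction t)
    case (Suc t)
    have grow: "B t \<union> parcs G `` B t \<subseteq> B (Suc t)"
      by (auto simp: BSuc step_def)
    show ?case
    proof (cases "k \<le> t + i")
      case True
      then have "Suc t + i - k = Suc (t + i - k)" by simp
      then show ?thesis using Suc True grow by auto
    next
      case False
      then have "i = k - 1 - t" "Suc t + i - k = 0" using Suc.prems by auto
      then show ?thesis using c[of i] Suc.prems by (auto simp: BSuc step_def new_def)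
    qed
  qed simp
  have "pverts G \<subseteq> B k"
  proof
    fix v assume "v \<in> pverts G"
    then obtain i where "i < k" "v \<in> fire G (c i) i" using cov by auto
    then show "v \<in> B k" using spread[of i k] by auto
  qed
  then have "B k = pverts G" using inside[of k] by auto
  moreover have "burning_round G (B t) (B (Suc t))" if "t < k" for t
    using new[of "B t" t] that unfolding burning_round_def BSuc step_def by auto
  ultimately show ?thesis
    unfolding burnable_within_def using B0 by blast
qed

text \<open>
  Conversely, the vertices chosen in a burning process are centres of balls that cover the
  graph.  A round in which no vertex can be chosen is given an arbitrary vertex as its centre.
\<close>
lemma cover_of_burnable_within:
  assumes "burnable_within G k" and "pverts G \<noteq> {}"
  shows "\<exists>c. (\<forall>i. c i \<in> pverts G) \<and> pverts G \<subseteq> (\<Union>i<k. fire G (c i) i)"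
proof -
  obtain B where B0: "B 0 = {}" and round: "\<And>t. t < k \<Longrightarrow> burning_round G (B t) (B (Suc t))"
    and Bk: "B k = pverts G"
    using assms(1) unfolding burnable_within_def by auto
  have "\<exists>x. x \<in> pverts G \<and> (t < k \<longrightarrow> B (Suc t) \<subseteq> insert x (B t \<union> parcs G `` B t))" for t
    using round[of t] assms(2) unfolding burning_round_def
    by (cases "t < k") blast+
  then obtain x where x: "\<And>t. x t \<in> pverts G"
    and step: "\<And>t. t < k \<Longrightarrow> B (Suc t) \<subseteq> insert (x t) (B t \<union> parcs G `` B t)"
    by metis
  have lit: "\<exists>j<t. v \<in> fire G (x j) (t - 1 - j)" if "t \<le> k" "v \<in> B t" for t v
    using that
  proof (induction t arbitrary: v)
    case (Suc t)
    have old: "\<exists>j<Suc t. v \<in> fire G (x j) (Suc t - 1 - j)"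
      if w: "w \<in> B t" "v = w \<or> (w, v) \<in> parcs G" for w
    proof -
      obtain j where j: "j < t" "w \<in> fire G (x j) (t - 1 - j)"
        using Suc.IH[OF Suc_leD[OF Suc.prems(1)] w(1)] by auto
      then have "Suc t - 1 - j = Suc (t - 1 - j)" by simp
      then show ?thesis using j w(2) by (intro exI[of _ j]) auto
    qed
    have "v = x t \<or> v \<in> B t \<or> v \<in> parcs G `` B t"
      using step[of t] Suc.prems by auto
    then show ?case
    proof (elim disjE)
      assume "v = x t"
      then show ?thesis by (intro exI[of _ t]) simp
    qed (use old in auto)
  qed (simp add: B0)
  have "\<exists>i<k. v \<in> fire G (x (k - 1 - i)) i" if v: "v \<in> pverts G" for v
  proof -
    obtain j where "j < k" "v \<in> fire G (x j) (k - 1 - j)"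
      using lit[of k v] v Bk by auto
    then show ?thesis by (intro exI[of _ "k - 1 - j"]) auto
  qed
  then show ?thesis using x by (intro exI[of _ "\<lambda>i. x (k - 1 - i)"]) auto
qed


section \<open>Blocks\<close>

text \<open>
  Along a path, a ball of radius \<open>i\<close> covers a block of at most \<open>2 * i + 1\<close> vertices.
\<close>
definition blocks :: "nat set \<Rightarrow> nat" where
  "blocks S = (\<Sum>i\<in>S. 2 * i + 1)"

lemma blocks_lessThan: "blocks {..<k} = k^2"
  by (induction k) (simp_all add: blocks_def lessThan_Suc power2_eq_square)

lemma blocks_insert [simp]: "finite S \<Longrightarrow> i \<notin> S \<Longrightarrow> blocks (insert i S) = 2 * i + 1 + blocks S"
  and blocks_empty [simp]: "blocks {} = 0"
  by (simp_all add: blocks_def)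

text \<open>
  The ball of radius \<open>m\<close> is set aside for the hub; of the other radii below \<open>k\<close>, those in \<open>S j\<close>
  are spent on the \<open>j\<close>-th of the three paths that are left when the hub is removed.  Radii that
  belong to no \<open>S j\<close> with \<open>j < 3\<close> are wasted.
\<close>
definition fire_split :: "nat \<Rightarrow> nat \<Rightarrow> (nat \<Rightarrow> nat set) \<Rightarrow> bool" where
  "fire_split k m S \<longleftrightarrow> m < k \<and> (\<forall>j. S j \<subseteq> {..<k} - {m}) \<and> disjoint_family S"

text \<open>This is where \<open>k^2 = 1 + 3 + \<dots> + (2 * k - 1)\<close> enters the counting.\<close>
lemma fire_split_total:
  assumes "fire_split k m S"
  shows "blocks (S 0) + blocks (S 1) + blocks (S 2) + (2 * m + 1) \<le> k^2"
proof -
  have fin: "finite (S j)" for j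
    using assms finite_subset unfolding fire_split_def by (metis finite_Diff finite_lessThan)
  have dis: "S i \<inter> S j = {}" if "i \<noteq> j" for i j
    using assms that by (auto simp: fire_split_def disjoint_family_on_def)
  have "m \<notin> S j" for j using assms by (auto simp: fire_split_def)
  then have "blocks (S 0) + blocks (S 1) + blocks (S 2) + (2 * m + 1)
      = blocks (insert m (S 0 \<union> S 1 \<union> S 2))"
    using fin dis[of 0 1] dis[of 0 2] dis[of 1 2]
    by (subst blocks_insert) (auto simp: blocks_def sum.union_disjoint Int_Un_distrib2)
  also have "\<dots> \<le> blocks {..<k}"
    unfolding blocks_def using assms by (intro sum_mono2) (auto simp: fire_split_def)
  finally show ?thesis by (simp add: blocks_lessThan)
qed


section \<open>Spiders with at most \<open>k^2\<close> vertices\<close>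

lemma sort_three:
  fixes l :: "nat \<Rightarrow> nat"
  obtains x y z :: nat where "(x, y, z) \<in> {(0,1,2), (0,2,1), (1,0,2), (1,2,0), (2,0,1), (2,1,0)}"
    and "l y \<le> l x" and "l z \<le> l y"
proof -
  have "(l 1 \<le> l 0 \<and> l 2 \<le> l 1) \<or> (l 2 \<le> l 0 \<and> l 1 \<le> l 2) \<or> (l 0 \<le> l 1 \<and> l 2 \<le> l 0) \<or>
    (l 2 \<le> l 1 \<and> l 0 \<le> l 2) \<or> (l 0 \<le> l 2 \<and> l 1 \<le> l 0) \<or> (l 1 \<le> l 2 \<and> l 0 \<le> l 1)"
    by linarith
  then show thesis
    using that[of 0 1 2] that[of 0 2 1] that[of 1 0 2] that[of 1 2 0] that[of 2 0 1] that[of 2 1 0]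
    by auto
qed

text \<open>
  A sufficient plan for a spider with legs of lengths \<open>l 0, l 1, l 2\<close>: a ball of radius \<open>s + d\<close>
  centred on leg \<open>p\<close> at distance \<open>d\<close> from the hub covers depth \<open>s\<close> on every leg and depth
  \<open>s + 2 * d\<close> on leg \<open>p\<close>; blocks cover what is left.
\<close>
definition spider_split :: "nat \<Rightarrow> (nat \<Rightarrow> nat) \<Rightarrow> bool" where
  "spider_split k l \<longleftrightarrow> (\<exists>s d p S. fire_split k (s + d) S \<and>
     (\<forall>j<3. l j \<le> s + (if p = j then 2 * d else 0) + blocks (S j)))"

text \<open>
  If a leg is long enough, the ball of the largest radius is spent on a block at its outer end.
\<close>
lemma spider_split_extend:
  assumes "spider_split k (l(j := l j - (2 * k + 1)))"
  shows "spider_split (Suc k) l"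
proof -
  obtain s d p S where *: "fire_split k (s + d) S"
    and l: "\<forall>i<3. (l(j := l j - (2 * k + 1))) i \<le> s + (if p = i then 2 * d else 0) + blocks (S i)"
    using assms unfolding spider_split_def by blast
  have fin: "finite (S j)" and k: "k \<notin> S i" for i
    using * finite_subset[of "S j" "{..<k} - {s + d}"] by (auto simp: fire_split_def)
  have "fire_split (Suc k) (s + d) (S(j := insert k (S j)))"
    using * k by (fastforce simp: fire_split_def disjoint_family_on_def)
  moreover have "l i \<le> s + (if p = i then 2 * d else 0) + blocks ((S(j := insert k (S j))) i)" if "i < 3" for i
    using l[rule_format, OF that] fin k by (cases "i = j") auto
  ultimately show ?thesis unfolding spider_split_def by blast
qed

text \<open>
  If every leg is too short for the previous step, the largest ball is placed at the hub.  At
  most \<open>k\<close> vertices remain on each leg, which for \<open>5 \<le> k\<close> fit into one block each.  For smaller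
  \<open>k\<close> the blocks are assigned according to the order of the legs by length.  For two spiders
  the largest ball is moved to distance 1 from the hub: the path made of two legs of length 4
  (\<open>k = 2\<close>) and the spider with three legs of length 5 (\<open>k = 3\<close>).
\<close>
lemma spider_split_short:
  assumes short: "\<And>j. j < 3 \<Longrightarrow> l j \<le> 2 * k" and total: "l 0 + l 1 + l 2 < (Suc k)^2"
  shows "spider_split (Suc k) l"
proof -
  have hub: "spider_split (Suc k) l"
    if "\<And>j. S j \<subseteq> {..<k}" "disjoint_family S" "\<And>j. j < 3 \<Longrightarrow> l j \<le> k + blocks (S j)" for S
    unfolding spider_split_def fire_split_def
    using that by (intro exI[of _ k] exI[of _ 0] exI[of _ S]) fastforce
  obtain x y z where xyz: "(x, y, z) \<in> {(0,1,2), (0,2,1), (1,0,2), (1,2,0), (2,0,1), (2,1,0::nat)}"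
    and le: "l y \<le> l x" "l z \<le> l y"
    using sort_three[of l] by blast
  have ne: "x \<noteq> y" "x \<noteq> z" "y \<noteq> z" "x < 3" using xyz by auto
  have cases3: "j = x \<or> j = y \<or> j = z" if "j < 3" for j
  proof -
    have "j = 0 \<or> j = 1 \<or> j = 2" using that by linarith
    then show ?thesis using xyz by auto
  qed
  have sum: "l x + l y + l z < (Suc k)^2" using xyz total by auto
  have small: "l x \<le> 2 * k" using short ne by blast
  consider "k = 0" | "k = 1" | "k = 2" | "k = 3" | "k = 4" | "5 \<le> k" by linarith
  then show ?thesis
  proof cases
    case 1
    then have "l x = 0" "l y = 0" "l z = 0" using sum by auto
    then show ?thesis
      by (intro hub[of "\<lambda>_. {}"]) (auto simp: disjoint_family_on_def dest!: cases3)
  next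
    case 2
    then have "l x \<le> 2" "l y \<le> 1" "l z \<le> 1" using sum le small by (auto simp: power2_eq_square)
    then show ?thesis using 2 ne
      by (intro hub[of "(\<lambda>_. {})(x := {0})"]) (auto simp: disjoint_family_on_def dest!: cases3)
  next
    case 3
    then have *: "l x \<le> 4" "l y \<le> 4" "l z \<le> 2" using sum le small by (auto simp: power2_eq_square)
    show ?thesis
    proof (cases "l y \<le> 3")
      case True
      then show ?thesis using 3 ne *
        by (intro hub[of "(\<lambda>_. {})(x := {1}, y := {0})"])
          (auto simp: disjoint_family_on_def dest!: cases3)
    next
      case False
      then have "l x = 4" "l y = 4" "l z = 0" using 3 sum le * by (auto simp: power2_eq_square)
      then show ?thesis unfolding spider_split_def fire_split_def using 3 ne
        by (intro exI[of _ 1] exI[of _ x] exI[of _ "(\<lambda>_. {})(x := {0}, y := {1})"])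
          (auto simp: disjoint_family_on_def dest!: cases3)
    qed
  next
    case 4
    then have *: "l x \<le> 6" "l y \<le> 6" "l z \<le> 5" using sum le small by (auto simp: power2_eq_square)
    show ?thesis
    proof (cases "l z \<le> 4")
      case True
      then show ?thesis using 4 ne *
        by (intro hub[of "(\<lambda>_. {})(x := {1}, y := {2}, z := {0})"])
          (auto simp: disjoint_family_on_def dest!: cases3)
    next
      case False
      then have "l x = 5" "l y = 5" "l z = 5" using 4 sum le * by (auto simp: power2_eq_square)
      then show ?thesis unfolding spider_split_def fire_split_def using 4 ne
        by (intro exI[of _ 2] exI[of _ 1] exI[of _ x]
            exI[of _ "(\<lambda>_. {})(x := {0}, y := {1}, z := {2})"])
          (auto simp: disjoint_family_on_def dest!: cases3)
    qed
  next
    case 5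
    then have "l x \<le> 8" "l y \<le> 8" "l z \<le> 8" using le small by auto
    then show ?thesis using 5 ne
      by (intro hub[of "(\<lambda>_. {})(x := {3}, y := {2}, z := {0, 1})"])
        (auto simp: disjoint_family_on_def dest!: cases3)
  next
    case 6
    have "l j \<le> k + blocks (if j < 3 then {k - 1 - j} else {})" if "j < 3" for j
      using 6 short[OF that] that by auto
    then show ?thesis using 6
      by (intro hub[of "\<lambda>j. if j < 3 then {k - 1 - j} else {}"]) (auto simp: disjoint_family_on_def)
  qed
qed

lemma spider_split_exists:
  assumes "l 0 + l 1 + l 2 < k^2"
  shows "spider_split k l"
  using assms
proof (induction k arbitrary: l)
  case (Suc k)
  show ?case
  proof (cases "\<exists>j<3. 2 * k + 1 \<le> l j")
    case True
    then obtain j where j: "j < 3" "2 * k + 1 \<le> l j" by auto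
    let ?l = "l(j := l j - (2 * k + 1))"
    have "j = 0 \<or> j = 1 \<or> j = 2" using j(1) by auto
    then have "?l 0 + ?l 1 + ?l 2 + (2 * k + 1) = l 0 + l 1 + l 2" using j(2) by auto
    then have "?l 0 + ?l 1 + ?l 2 < k^2" using Suc.prems by (simp add: power2_eq_square)
    then show ?thesis using spider_split_extend Suc.IH by blast
  next
    case False
    then show ?thesis using Suc.prems by (intro spider_split_short) force+
  qed
qed simp

text \<open>Blocks laid end to end: balls with the radii in \<open>S\<close> cover \<open>blocks S\<close> consecutive positions.\<close>
lemma blocks_cover_segment:
  assumes "finite S"
  shows "\<exists>c. \<forall>i. l < i \<and> i \<le> l + blocks S \<longrightarrow> (\<exists>m\<in>S. c m \<le> i + m \<and> i \<le> c m + m)"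
  using assms
proof (induction S rule: finite_induct)
  case (insert m S)
  then obtain c where c: "\<forall>i. l < i \<and> i \<le> l + blocks S \<longrightarrow> (\<exists>m\<in>S. c m \<le> i + m \<and> i \<le> c m + m)"
    by blast
  have "\<exists>m'\<in>insert m S. (c(m := l + blocks S + m + 1)) m' \<le> i + m' \<and> i \<le> (c(m := l + blocks S + m + 1)) m' + m'"
    if i: "l < i" "i \<le> l + blocks (insert m S)" for i
  proof (cases "i \<le> l + blocks S")
    case True
    with c i(1) obtain m' where "m' \<in> S" "c m' \<le> i + m'" "i \<le> c m' + m'" by blast
    then show ?thesis using insert.hyps by (intro bexI[of _ m']) auto
  next
    case False
    then show ?thesis using i insert.hyps by (intro bexI[of _ m]) auto
  qed
  then show ?case by blast
qed simp

text \<open>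
  Dropping the edge between \<open>Cyc (g - 1)\<close> and \<open>Cyc g\<close> leaves a spider with hub \<open>Cyc g\<close>;
  \<open>spider_vertex g j i\<close> is its vertex at distance \<open>i\<close> from the hub on leg \<open>j\<close>.
\<close>
fun spider_vertex :: "nat \<Rightarrow> nat \<Rightarrow> nat \<Rightarrow> uvertex" where
  "spider_vertex g j 0 = Cyc g"
| "spider_vertex g j (Suc i) = (if j = 0 then Cyc (Suc i) else if j = 1 then Arm1 (Suc i) else Arm2 (Suc i))"

definition leg_length :: "nat \<Rightarrow> nat \<Rightarrow> nat \<Rightarrow> nat \<Rightarrow> nat" where
  "leg_length g a1 a2 j = (if j = 0 then g - 1 else if j = 1 then a1 else a2)"

lemma spider_vertex_arc:
  assumes "3 \<le> g" "1 \<le> a1" "1 \<le> a2" and "i < leg_length g a1 a2 j"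
  shows "(spider_vertex g j i, spider_vertex g j (Suc i)) \<in> parcs (unicyclic2 g a1 a2)"
    and "(spider_vertex g j (Suc i), spider_vertex g j i) \<in> parcs (unicyclic2 g a1 a2)"
  using assms by (cases i; auto simp: unicyclic2_def unicyclic2_edges_def leg_length_def split: if_splits)+

lemma spider_vertex_in:
  assumes "3 \<le> g" "i \<le> leg_length g a1 a2 j"
  shows "spider_vertex g j i \<in> pverts (unicyclic2 g a1 a2)"
  using assms by (cases i) (auto simp: unicyclic2_def leg_length_def split: if_splits)

lemma fire_along_leg:
  assumes "3 \<le> g" "1 \<le> a1" "1 \<le> a2" and "i + m \<le> leg_length g a1 a2 j"
  shows "spider_vertex g j (i + m) \<in> fire (unicyclic2 g a1 a2) (spider_vertex g j i) m"
    and "spider_vertex g j i \<in> fire (unicyclic2 g a1 a2) (spider_vertex g j (i + m)) m"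
proof -
  have "spider_vertex g j (i + m) \<in> fire (unicyclic2 g a1 a2) (spider_vertex g j i) m \<and>
    spider_vertex g j i \<in> fire (unicyclic2 g a1 a2) (spider_vertex g j (i + m)) m"
    using assms(4)
  proof (induction m)
    case (Suc m)
    have "spider_vertex g j (i + m) \<in> fire (unicyclic2 g a1 a2) (spider_vertex g j (i + Suc m)) 1"
      using spider_vertex_arc(2)[of g a1 a2 "i + m" j] assms Suc.prems by auto
    then have "spider_vertex g j i \<in> fire (unicyclic2 g a1 a2) (spider_vertex g j (i + Suc m)) (1 + m)"
      using Suc by (intro fire_trans[of "spider_vertex g j (i + m)"]) auto
    moreover have "spider_vertex g j (i + Suc m) \<in> fire (unicyclic2 g a1 a2) (spider_vertex g j i) (Suc m)"
      using spider_vertex_arc(1)[of g a1 a2 "i + m" j] assms Suc by auto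
    ultimately show ?case by simp
  qed simp
  then show "spider_vertex g j (i + m) \<in> fire (unicyclic2 g a1 a2) (spider_vertex g j i) m"
    and "spider_vertex g j i \<in> fire (unicyclic2 g a1 a2) (spider_vertex g j (i + m)) m" by auto
qed

text \<open>
  A plan may place a centre beyond the end of a leg.  Moving such a centre back to the end brings
  it closer to every vertex of the leg, so the clamped balls still cover the graph.
\<close>
lemma burnable_of_spider_split:
  assumes "3 \<le> g" "1 \<le> a1" "1 \<le> a2" and "spider_split k (leg_length g a1 a2)"
  shows "burnable_within (unicyclic2 g a1 a2) k"
proof -
  let ?G = "unicyclic2 g a1 a2" and ?l = "leg_length g a1 a2" and ?v = "spider_vertex g"
  interpret pair_graph ?G using assms by (intro pair_graph_unicyclic2)
  obtain s d p S where split: "fire_split k (s + d) S"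
    and l: "\<And>j. j < 3 \<Longrightarrow> ?l j \<le> s + (if p = j then 2 * d else 0) + blocks (S j)"
    using assms(4) unfolding spider_split_def by blast
  have along: "?v j i \<in> fire ?G (?v j e) m" if "i \<le> ?l j" "e \<le> ?l j" "e \<le> i + m" "i \<le> e + m" for i j e m
  proof (cases "e \<le> i")
    case True
    then have "?v j i \<in> fire ?G (?v j e) (i - e)"
      using fire_along_leg(1)[of g a1 a2 e "i - e" j] assms that by auto
    then show ?thesis by (rule fire_le) (use that in auto)
  next
    case False
    then have "?v j i \<in> fire ?G (?v j e) (e - i)"
      using fire_along_leg(2)[of g a1 a2 i "e - i" j] assms that by auto
    then show ?thesis by (rule fire_le) (use that in auto)
  qed
  define near where "near j = s + (if p = j then 2 * d else 0)" for j
  have fin: "finite (S j)" for j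
    using split finite_subset[of "S j" "{..<k} - {s + d}"] by (auto simp: fire_split_def)
  have "\<exists>c. \<forall>i. near j < i \<and> i \<le> near j + blocks (S j) \<longrightarrow> (\<exists>m\<in>S j. c m \<le> i + m \<and> i \<le> c m + m)" for j
    by (rule blocks_cover_segment[OF fin])
  then obtain e where e: "\<And>j i. near j < i \<Longrightarrow> i \<le> near j + blocks (S j) \<Longrightarrow>
      \<exists>m\<in>S j. e j m \<le> i + m \<and> i \<le> e j m + m"
    by metis
  define h where "h = min d (?l p)"
  define c where "c m = (if m = s + d then ?v p h else
      (let j = (THE j. m \<in> S j) in ?v j (min (e j m) (?l j))))" for m
  have c_hub: "c (s + d) = ?v p h" by (simp add: c_def)
  have c_seg: "c m = ?v j (min (e j m) (?l j))" if "m \<in> S j" for m j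
  proof -
    have "j' = j" if "m \<in> S j'" for j'
      using split that \<open>m \<in> S j\<close> unfolding fire_split_def disjoint_family_on_def by blast
    then have "(THE j. m \<in> S j) = j" using that by blast
    moreover have "m \<noteq> s + d" using split that by (auto simp: fire_split_def)
    ultimately show ?thesis by (simp add: c_def)
  qed
  have c_in: "c m \<in> pverts ?G" for m
    using spider_vertex_in[OF assms(1)] by (auto simp: c_def h_def Let_def)
  have covered: "?v j i \<in> (\<Union>m<k. fire ?G (c m) m)" if ji: "j < 3" "i \<le> ?l j" for j i
  proof (cases "i \<le> near j")
    case True
    have "?v j i \<in> fire ?G (?v p h) (s + d)"
    proof (cases "p = j")
      case True
      have "?v j i \<in> fire ?G (?v j h) (s + d)"
        using True \<open>i \<le> near j\<close> ji(2) by (intro along) (auto simp: h_def near_def)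
      then show ?thesis using True by simp
    next
      case False
      have "?v p 0 \<in> fire ?G (?v p h) h" by (rule along) (auto simp: h_def)
      moreover have "?v j i \<in> fire ?G (?v j 0) i" by (rule along) (use ji in auto)
      ultimately have "?v j i \<in> fire ?G (?v p h) (h + i)" by (auto intro: fire_trans)
      then show ?thesis by (rule fire_le) (use \<open>i \<le> near j\<close> False in \<open>auto simp: h_def near_def\<close>)
    qed
    then show ?thesis using split unfolding c_hub[symmetric] fire_split_def by blast
  next
    case False
    then obtain m where m: "m \<in> S j" "e j m \<le> i + m" "i \<le> e j m + m"
      using e[of j i] l[OF ji(1)] ji(2) by (auto simp: near_def)
    then have "?v j i \<in> fire ?G (c m) m"
      unfolding c_seg[OF m(1)] using ji(2) by (intro along) auto
    then show ?thesis using split m(1) by (auto simp: fire_split_def)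
  qed
  have "v \<in> (\<Union>m<k. fire ?G (c m) m)" if v: "v \<in> pverts ?G" for v
  proof (cases v)
    case (Cyc i)
    show ?thesis
    proof (cases "i = g")
      case True
      then show ?thesis using covered[of 0 0] Cyc by simp
    next
      case False
      then show ?thesis using covered[of 0 i] Cyc v
        by (cases i) (auto simp: unicyclic2_def leg_length_def)
    qed
  next
    case (Arm1 i)
    then show ?thesis using covered[of 1 i] v by (cases i) (auto simp: unicyclic2_def leg_length_def)
  next
    case (Arm2 i)
    then show ?thesis using covered[of 2 i] v by (cases i) (auto simp: unicyclic2_def leg_length_def)
  qed
  then show ?thesis using c_in by (intro burnable_within_of_cover[of k c]) auto
qed


section \<open>Balls in the unicyclic graph\<close>

text \<open>The graph distance, in closed form: \<open>Cyc g\<close> is the hub at which the three legs meet.\<close>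
fun vdist :: "nat \<Rightarrow> uvertex \<Rightarrow> uvertex \<Rightarrow> int" where
  "vdist g (Cyc i) (Cyc j) = min \<bar>int i - int j\<bar> (int g - \<bar>int i - int j\<bar>)"
| "vdist g (Cyc i) (Arm1 e) = min (int i) (int g - int i) + int e"
| "vdist g (Cyc i) (Arm2 e) = min (int i) (int g - int i) + int e"
| "vdist g (Arm1 e) (Cyc i) = int e + min (int i) (int g - int i)"
| "vdist g (Arm1 e) (Arm1 f) = \<bar>int e - int f\<bar>"
| "vdist g (Arm1 e) (Arm2 f) = int e + int f"
| "vdist g (Arm2 e) (Cyc i) = int e + min (int i) (int g - int i)"
| "vdist g (Arm2 e) (Arm1 f) = int e + int f"
| "vdist g (Arm2 e) (Arm2 f) = \<bar>int e - int f\<bar>"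

fun leg :: "uvertex \<Rightarrow> nat" where
  "leg (Cyc _) = 0" | "leg (Arm1 _) = 1" | "leg (Arm2 _) = 2"

text \<open>The distance to the hub.\<close>
fun height :: "nat \<Rightarrow> uvertex \<Rightarrow> int" where
  "height g (Cyc i) = min (int i) (int g - int i)"
| "height g (Arm1 e) = int e"
| "height g (Arm2 e) = int e"

lemma vdist_self: "c \<in> pverts (unicyclic2 g a1 a2) \<Longrightarrow> vdist g c c = 0"
  by (cases c) (auto simp: unicyclic2_def)

lemma vdist_step:
  assumes "c \<in> pverts (unicyclic2 g a1 a2)" and "(x, y) \<in> parcs (unicyclic2 g a1 a2)"
  shows "vdist g c y \<le> vdist g c x + 1"
  using assms by (cases c) (auto simp: unicyclic2_def unicyclic2_edges_def)

lemma vdist_fire: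
  assumes "c \<in> pverts (unicyclic2 g a1 a2)" and "x \<in> fire (unicyclic2 g a1 a2) c m"
  shows "vdist g c x \<le> int m"
  using assms(2)
proof (induction m arbitrary: x)
  case 0
  then show ?case using vdist_self[OF assms(1)] by simp
next
  case (Suc m)
  from Suc.prems consider "x \<in> fire (unicyclic2 g a1 a2) c m"
    | y where "y \<in> fire (unicyclic2 g a1 a2) c m" "(y, x) \<in> parcs (unicyclic2 g a1 a2)"
    by auto
  then show ?case
  proof cases
    case 1 then show ?thesis using Suc.IH[of x] by simp
  next
    case 2 then show ?thesis using Suc.IH[of y] vdist_step[OF assms(1) 2(2)] by simp
  qed
qed

lemma vdist_hub: "c \<in> pverts (unicyclic2 g a1 a2) \<Longrightarrow> vdist g c (Cyc g) = height g c"
  by (cases c) (auto simp: unicyclic2_def)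

text \<open>Every path between different legs passes through the hub.\<close>
lemma vdist_other_leg: "leg c \<noteq> leg x \<Longrightarrow> vdist g c x = height g c + height g x"
  by (cases c; cases x) auto

lemma height_nonneg: "c \<in> pverts (unicyclic2 g a1 a2) \<Longrightarrow> 0 \<le> height g c"
  by (cases c) (auto simp: unicyclic2_def)

lemma card_le_of_subset_image:
  fixes l u :: int
  assumes "A \<subseteq> f ` {l..u}" and "int n = u - l + 1"
  shows "card A \<le> n"
  using assms surj_card_le[of "{l..u}" A f] by auto

text \<open>
  A ball centred on a leg meets that leg in a block.  On the cycle, the block is an interval of
  integers wrapped around at most once.
\<close>
lemma card_ball_leg:
  assumes "c \<in> pverts (unicyclic2 g a1 a2)"
  shows "card {x \<in> pverts (unicyclic2 g a1 a2). leg x = leg c \<and> vdist g c x \<le> int m} \<le> 2 * m + 1"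
    (is "card ?A \<le> _")
proof (cases c)
  case (Cyc j)
  define f where "f z = Cyc (if z \<le> 0 then nat (z + int g) else if z > int g then nat (z - int g) else nat z)" for z
  have "?A \<subseteq> f ` {int j - int m..int j + int m}"
  proof
    fix x assume "x \<in> ?A"
    then obtain i where i: "x = Cyc i" "1 \<le> i" "i \<le> g"
      "min \<bar>int j - int i\<bar> (int g - \<bar>int j - int i\<bar>) \<le> int m"
      by (cases x) (auto simp: unicyclic2_def Cyc)
    then consider "\<bar>int j - int i\<bar> \<le> int m" | "int g - (int j - int i) \<le> int m"
      | "int g - (int i - int j) \<le> int m" by linarith
    then show "x \<in> f ` {int j - int m..int j + int m}"
    proof cases
      case 1 then show ?thesis using i by (intro image_eqI[of _ _ "int i"]) (auto simp: f_def)
    next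
      case 2 then show ?thesis using i assms
        by (intro image_eqI[of _ _ "int i + int g"]) (auto simp: f_def Cyc unicyclic2_def)
    next
      case 3 then show ?thesis using i assms
        by (intro image_eqI[of _ _ "int i - int g"]) (auto simp: f_def Cyc unicyclic2_def)
    qed
  qed
  from card_le_of_subset_image[OF this, of "2 * m + 1"] show ?thesis by simp
next
  case (Arm1 e)
  have "?A \<subseteq> (Arm1 \<circ> nat) ` {int e - int m..int e + int m}"
  proof
    fix x assume "x \<in> ?A"
    then obtain i where "x = Arm1 i" "\<bar>int e - int i\<bar> \<le> int m"
      by (cases x) (auto simp: Arm1)
    then show "x \<in> (Arm1 \<circ> nat) ` {int e - int m..int e + int m}"
      by (intro image_eqI[of _ _ "int i"]) auto
  qed
  from card_le_of_subset_image[OF this, of "2 * m + 1"] show ?thesis by simp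
next
  case (Arm2 e)
  have "?A \<subseteq> (Arm2 \<circ> nat) ` {int e - int m..int e + int m}"
  proof
    fix x assume "x \<in> ?A"
    then obtain i where "x = Arm2 i" "\<bar>int e - int i\<bar> \<le> int m"
      by (cases x) (auto simp: Arm2)
    then show "x \<in> (Arm2 \<circ> nat) ` {int e - int m..int e + int m}"
      by (intro image_eqI[of _ _ "int i"]) auto
  qed
  from card_le_of_subset_image[OF this, of "2 * m + 1"] show ?thesis by simp
qed

text \<open>
  If the centre is at distance \<open>d\<close> from the hub, the ball of radius \<open>s + d\<close> contains the
  ball of radius \<open>s\<close> around the hub.  What it has in addition on the leg of the
  centre occupies the positions \<open>s + 1, \<dots>, s + 2 * d\<close>, counted from the hub towards the centre.
\<close>
lemma card_ball_leg_beyond: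
  assumes "c \<in> pverts (unicyclic2 g a1 a2)" and "height g c = int d"
  shows "card {x \<in> pverts (unicyclic2 g a1 a2). leg x = leg c \<and> vdist g c x \<le> int (s + d) \<and>
    int s < height g x} \<le> 2 * d"
    (is "card ?A \<le> _")
proof -
  \<comment> \<open>On the cycle, count in the direction in which the centre is nearer to the hub.\<close>
  define f where "f z = (case c of Cyc j \<Rightarrow> if 2 * j \<le> g then Cyc (nat z) else Cyc (nat (int g - z))
    | Arm1 _ \<Rightarrow> Arm1 (nat z) | Arm2 _ \<Rightarrow> Arm2 (nat z))" for z
  have "?A \<subseteq> f ` {int s + 1..int s + 2 * int d}"
  proof
    fix x assume x: "x \<in> ?A"
    show "x \<in> f ` {int s + 1..int s + 2 * int d}"
    proof (cases c)
      case (Cyc j)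
      with x obtain i where i: "x = Cyc i" "1 \<le> i" "i \<le> g" "int s < min (int i) (int g - int i)"
        "min \<bar>int j - int i\<bar> (int g - \<bar>int j - int i\<bar>) \<le> int (s + d)"
        by (cases x) (auto simp: unicyclic2_def)
      show ?thesis
      proof (cases "2 * j \<le> g")
        case True
        then have "d = j" using assms(2) by (simp add: Cyc)
        then show ?thesis using True i
          by (intro image_eqI[of _ _ "int i"]) (auto simp: f_def Cyc)
      next
        case False
        then have "int d = int g - int j" using assms(2) by (simp add: Cyc)
        then show ?thesis using False i assms(1)
          by (intro image_eqI[of _ _ "int g - int i"]) (auto simp: f_def Cyc unicyclic2_def)
      qed
    next
      case (Arm1 e)
      with x obtain i where "x = Arm1 i" "int s < int i" "\<bar>int e - int i\<bar> \<le> int (s + d)"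
        by (cases x) auto
      then show ?thesis using assms(2) Arm1
        by (intro image_eqI[of _ _ "int i"]) (auto simp: f_def)
    next
      case (Arm2 e)
      with x obtain i where "x = Arm2 i" "int s < int i" "\<bar>int e - int i\<bar> \<le> int (s + d)"
        by (cases x) auto
      then show ?thesis using assms(2) Arm2
        by (intro image_eqI[of _ _ "int i"]) (auto simp: f_def)
    qed
  qed
  from card_le_of_subset_image[OF this, of "2 * d"] show ?thesis by simp
qed

text \<open>
  The reduction to arithmetic.  Of all balls that cover the graph, take the one that reaches
  deepest beyond the hub, say to depth \<open>s\<close>, and let \<open>d\<close> be the distance of its centre from the
  hub.  Any other ball that spreads across the hub stays, outside its own leg, within
  depth \<open>s\<close>; so beyond depth \<open>s\<close> it contributes only to its own leg, and there only a block.  The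
  deepest ball itself contributes at most \<open>2 * d\<close> further vertices, on its own leg \<open>p\<close>.
\<close>
lemma fire_split_of_burnable:
  assumes "g \<ge> 3" "a1 \<ge> 1" "a2 \<ge> 1" and "burnable_within (unicyclic2 g a1 a2) q"
  shows "\<exists>s d p S. fire_split q (s + d) S \<and>
    g - 1 \<le> 2 * s + (if p = (0::nat) then 2 * d else 0) + blocks (S 0) \<and>
    a1 \<le> s + (if p = 1 then 2 * d else 0) + blocks (S 1) \<and>
    a2 \<le> s + (if p = 2 then 2 * d else 0) + blocks (S 2)"
proof -
  let ?G = "unicyclic2 g a1 a2"
  have hub: "Cyc g \<in> pverts ?G" using assms(1) by (auto simp: unicyclic2_def)
  obtain c where c: "\<And>i. c i \<in> pverts ?G" and cov: "pverts ?G \<subseteq> (\<Union>i<q. fire ?G (c i) i)"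
    using cover_of_burnable_within[OF assms(4)] hub by blast
  have near: "\<exists>i<q. vdist g (c i) x \<le> int i" if "x \<in> pverts ?G" for x
    using cov that vdist_fire[OF c] by blast
  define reach where "reach i = int i - height g (c i)" for i
  obtain i0 where i0: "i0 < q" "0 \<le> reach i0"
    using near[OF hub] vdist_hub[OF c] by (auto simp: reach_def)
  have "Max (reach ` {..<q}) \<in> reach ` {..<q}" using i0 by (intro Max_in) auto
  then obtain m where m: "m < q" and "reach m = Max (reach ` {..<q})" by auto
  then have max: "reach i \<le> reach m" if "i < q" for i using that by simp
  define s where "s = nat (reach m)"
  define d where "d = nat (height g (c m))"
  have s: "int s = reach m" using i0 max[of i0] by (simp add: s_def)
  have d: "height g (c m) = int d" using height_nonneg[OF c] by (simp add: d_def)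
  have sd: "s + d = m" using s d by (simp add: reach_def)
  define S where "S j = {i. i < q \<and> i \<noteq> m \<and> leg (c i) = j}" for j
  have split: "fire_split q (s + d) S"
    using m unfolding fire_split_def sd by (auto simp: S_def disjoint_family_on_def)
  define X where "X j = {x \<in> pverts ?G. leg x = j \<and> int s < height g x}" for j
  define A where "A j i = {x \<in> pverts ?G. leg x = j \<and> vdist g (c i) x \<le> int i}" for j i
  define Z where "Z j = {x \<in> pverts ?G. leg x = j \<and> vdist g (c m) x \<le> int (s + d) \<and> int s < height g x}" for j
  have fin: "finite (pverts ?G)" by (simp add: unicyclic2_def)
  have X_le: "card (X j) \<le> (if leg (c m) = j then 2 * d else 0) + blocks (S j)" for j
  proof -
    have sub: "X j \<subseteq> (if leg (c m) = j then Z j else {}) \<union> (\<Union>i\<in>S j. A j i)"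
    proof
      fix x assume x: "x \<in> X j"
      then obtain i where i: "i < q" "vdist g (c i) x \<le> int i" using near by (auto simp: X_def)
      have "leg (c i) = j"
      proof (rule ccontr)
        assume "leg (c i) \<noteq> j"
        then have "height g x \<le> reach i"
          using x i(2) vdist_other_leg[of "c i" x g] by (simp add: X_def reach_def)
        then show False using x max[OF i(1)] s by (simp add: X_def)
      qed
      then show "x \<in> (if leg (c m) = j then Z j else {}) \<union> (\<Union>i\<in>S j. A j i)"
        using x i sd by (cases "i = m") (auto simp: X_def Z_def A_def S_def)
    qed
    have finS: "finite (S j)" by (simp add: S_def)
    have "card (X j) \<le> card ((if leg (c m) = j then Z j else {}) \<union> (\<Union>i\<in>S j. A j i))"
      by (rule card_mono[OF _ sub]) (use fin finS in \<open>auto simp: Z_def A_def\<close>)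
    also have "\<dots> \<le> card (if leg (c m) = j then Z j else {}) + card (\<Union>i\<in>S j. A j i)"
      by (rule card_Un_le)
    also have "card (\<Union>i\<in>S j. A j i) \<le> (\<Sum>i\<in>S j. card (A j i))"
      by (rule card_UN_le[OF finS])
    also have "\<dots> \<le> blocks (S j)"
      unfolding blocks_def A_def using card_ball_leg[OF c] by (intro sum_mono) (auto simp: S_def)
    also have "card (if leg (c m) = j then Z j else {}) \<le> (if leg (c m) = j then 2 * d else 0)"
      using card_ball_leg_beyond[OF c d, of s] by (auto simp: Z_def)
    finally show ?thesis by simp
  qed
  have ge: "card B \<le> card (X j)" if "B \<subseteq> X j" for B j
    by (rule card_mono[OF _ that]) (simp add: X_def fin)
  have "Cyc ` {s + 1..<g - s} \<subseteq> X 0" "Arm1 ` {s + 1..a1} \<subseteq> X 1" "Arm2 ` {s + 1..a2} \<subseteq> X 2"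
    by (auto simp: X_def unicyclic2_def)
  from this[THEN ge] have "g - s - (s + 1) \<le> card (X 0)" "a1 - s \<le> card (X 1)" "a2 - s \<le> card (X 2)"
    by (simp_all add: card_image inj_on_def)
  then show ?thesis using split X_le[of 0] X_le[of 1] X_le[of 2]
    by (intro exI[of _ s] exI[of _ d] exI[of _ "leg (c m)"] exI[of _ S]) auto
qed


section \<open>Sums of distinct odd numbers\<close>

text \<open>
  Whether disjoint sublists of the given list have sums \<open>a\<close> and \<open>b\<close>.  The conditionals
  make the search by simplification stop as soon as an entry exceeds its target.
\<close>
fun packs :: "nat list \<Rightarrow> nat \<Rightarrow> nat \<Rightarrow> bool" where
  "packs [] a b \<longleftrightarrow> a = 0 \<and> b = 0"
| "packs (w # ws) a b \<longleftrightarrow> packs ws a b \<or> (if w \<le> a then packs ws (a - w) b else False) \<or>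
     (if w \<le> b then packs ws a (b - w) else False)"

declare packs.simps [simp del]

primrec odds :: "nat \<Rightarrow> nat list" where
  "odds 0 = []"
| "odds (Suc k) = (2 * k + 1) # odds k"

lemma packs_of_disjoint:
  assumes "S \<subseteq> {..<k}" "T \<subseteq> {..<k}" "S \<inter> T = {}"
  shows "packs (odds k) (blocks S) (blocks T)"
  using assms
proof (induction k arbitrary: S T)
  case (Suc k)
  have drop: "R - {k} \<subseteq> {..<k}" if "R \<subseteq> {..<Suc k}" for R
    using that by (auto simp: less_Suc_eq)
  have remove: "blocks R = 2 * k + 1 + blocks (R - {k})" if "k \<in> R" "R \<subseteq> {..<Suc k}" for R
    unfolding blocks_def using that finite_subset by (subst sum.remove[of _ k]) auto
  have IH: "packs (odds k) (blocks (S - {k})) (blocks (T - {k}))"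
    using Suc.prems by (intro Suc.IH drop) auto
  consider "k \<in> S" "k \<notin> T" | "k \<in> T" "k \<notin> S" | "k \<notin> S" "k \<notin> T" using Suc.prems by blast
  then show ?case
    by cases (use IH remove[of S] remove[of T] Suc.prems in \<open>auto simp: packs.simps\<close>)
qed (simp add: packs.simps blocks_def)

text \<open>
  Pairs of lengths that two disjoint sets of blocks cannot cover with a total excess of at
  most \<open>t\<close>.  Small odd numbers admit few sums: 2 is not a sum of distinct odd numbers, and 4,
  for instance, is one only as 1 + 3, which leaves nothing to make up 1 or 3.
\<close>
definition clash :: "nat \<Rightarrow> (int \<times> int) set" where
  "clash t = (if t \<le> 2 then {(2,2), (3,2)} else {}) \<union>
     (if t \<le> 1 then {(1,1), (3,3), (4,2), (5,5)} else {}) \<union>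
     (if t = 0 then {(2,0), (2,1), (4,1), (4,3), (4,4), (6,1), (6,4), (6,5), (6,6), (7,7),
        (8,4), (8,6), (10,4)} else {})"

lemma odds_5: "odds 5 = [9, 7, 5, 3, 1]" and odds_6: "odds 6 = [11, 9, 7, 5, 3, 1]"
  and odds_7: "odds 7 = [13, 11, 9, 7, 5, 3, 1]" and odds_8: "odds 8 = [15, 13, 11, 9, 7, 5, 3, 1]"
  and odds_9: "odds 9 = [17, 15, 13, 11, 9, 7, 5, 3, 1]"
  by (simp_all add: eval_nat_numeral)

lemma clash_not_packs:
  assumes "(x, y) \<in> clash t" and "i + j \<le> t"
  shows "nat x + i \<le> 10 \<and> nat y + j \<le> 10 \<and> \<not> packs (odds 5) (nat x + i) (nat y + j)"
proof -
  have "t \<le> 2" using assms(1) by (auto simp: clash_def split: if_splits)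
  have anti: "(x, y) \<in> clash t'" if "t' \<le> t" for t'
    using assms(1) that by (auto simp: clash_def split: if_splits)
  have "(i, j) = (0, 0) \<or> (i, j) \<in> {(1, 0), (0, 1)} \<or> (i, j) \<in> {(2, 0), (1, 1), (0, 2)} \<and> 2 \<le> t"
    using assms(2) \<open>t \<le> 2\<close> by simp presburger
  then consider "(x, y) \<in> clash 2" "(i, j) \<in> {(2, 0), (1, 1), (0, 2)}"
    | "(x, y) \<in> clash 1" "(i, j) \<in> {(1, 0), (0, 1)}"
    | "(x, y) \<in> clash 0" "i + j = 0"
    using anti[of 0] anti[of 1] anti[of 2] assms by auto
  then show ?thesis
  proof cases
    case 1
    from 1 show ?thesis by (auto simp: clash_def odds_5; simp add: packs.simps)
  next
    case 2
    from 2 show ?thesis by (auto simp: clash_def odds_5; simp add: packs.simps)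
  next
    case 3
    have "nat x \<le> 10 \<and> nat y \<le> 10 \<and> \<not> packs (odds 5) (nat x) (nat y)"
      using 3(1) by (auto simp: clash_def odds_5; simp add: packs.simps)
    then show ?thesis using 3(2) by simp
  qed
qed

text \<open>
  Each of the two covered totals is at most 10, so only the blocks \<open>1, 3, 5, 7, 9\<close> can be involved.
\<close>
lemma clash_not_disjoint:
  assumes "finite S" "finite T" "S \<inter> T = {}"
    and "(x, y) \<in> clash t"
    and "x \<le> int (blocks S)" "y \<le> int (blocks T)" "int (blocks S) + int (blocks T) \<le> x + y + int t"
  shows False
proof -
  define i j where "i = blocks S - nat x" and "j = blocks T - nat y"
  have "0 \<le> x" "0 \<le> y" using assms(4) by (auto simp: clash_def split: if_splits)
  then have S: "blocks S = nat x + i" and T: "blocks T = nat y + j" and "i + j \<le> t"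
    using assms(5-7) by (auto simp: i_def j_def)
  note no = clash_not_packs[OF assms(4) \<open>i + j \<le> t\<close>]
  have sub: "R \<subseteq> {..<5}" if "finite R" "blocks R \<le> 10" for R
  proof
    fix k assume "k \<in> R"
    then have "2 * k + 1 \<le> blocks R" unfolding blocks_def using that(1) by (intro member_le_sum) auto
    then show "k \<in> {..<5}" using that(2) by auto
  qed
  have "packs (odds 5) (blocks S) (blocks T)"
    using no S T assms(1-3) by (intro packs_of_disjoint sub) auto
  then show False using no S T by simp
qed

text \<open>
  \<open>(k, x, y)\<close>: no two disjoint sets of blocks taken from \<open>1, 3, \<dots>, 2 * k - 3\<close> have total lengths \<open>x\<close>
  and \<open>y\<close>.  Unlike for \<open>clash\<close>, the length \<open>y\<close> is so large that the bound on the blocks matters.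
\<close>
definition sporadic :: "(int \<times> int \<times> int) set" where
  "sporadic = {(6,1,11), (6,3,11),
     (7,1,13), (7,4,13), (7,6,13), (7,8,13), (7,10,13), (7,4,15), (7,6,15),
     (8,4,15), (8,6,15), (8,8,15), (8,15,15), (8,4,17), (8,6,17), (8,15,17), (8,4,19),
     (9,4,17), (9,6,17), (9,17,17), (9,4,19), (9,4,30), (10,4,19)}"

lemma sporadic_not_packs:
  "(k, x, y) \<in> sporadic \<Longrightarrow> \<not> packs (odds (nat k - 1)) (nat x) (nat y)"
  unfolding sporadic_def
  by (auto simp: odds_5 odds_6 odds_7 odds_8 odds_9; simp add: packs.simps)

text \<open>
  With the ball of radius \<open>q - 1\<close> placed at the hub, \<open>g - 2 * q + 1\<close> vertices of the cycle and \<open>a - q + 1\<close>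
  vertices of an arm of length \<open>a\<close> remain.  In the exceptional triples below, two of these
  three remainders form a pair that the blocks cannot cover.
\<close>
lemma excB1_clash: "(g, a1, a2) \<in> excB1 q \<Longrightarrow> g + a1 + a2 = q^2 + 2*q - 2 \<and> (a1 - q + 1, a2 - q + 1) \<in> clash 0"
  unfolding excB1_def by (elim insertE) (simp_all add: clash_def)

lemma excB2_clash: "(g, a1, a2) \<in> excB2 q \<Longrightarrow> g + a1 + a2 = q^2 + 2*q - 2 \<and> (g - 2*q + 1, a2 - q + 1) \<in> clash 0"
  unfolding excB2_def by (elim insertE) (simp_all add: clash_def)

lemma excB3_clash: "(g, a1, a2) \<in> excB3 q \<Longrightarrow> g + a1 + a2 = q^2 + 2*q - 2 \<and> (a2 - q + 1, g - 2*q + 1) \<in> clash 0"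
  unfolding excB3_def by (elim insertE) (simp_all add: clash_def)

lemma excB4_sporadic: "(g, a1, a2) \<in> excB4 \<Longrightarrow>
    \<exists>k\<in>{6,7,8,9,10}. g + a1 + a2 = k^2 + 2*k - 2 \<and> (k, a2 - k + 1, a1 - k + 1) \<in> sporadic"
  unfolding excB4_def by (elim insertE) (simp_all add: sporadic_def)

lemma excB5_sporadic: "(g, a1, a2) \<in> excB5 \<Longrightarrow>
    \<exists>k\<in>{6,7,8,9,10}. g + a1 + a2 = k^2 + 2*k - 2 \<and>
      (k, a2 - k + 1, g - 2*k + 1) \<in> sporadic"
  unfolding excB5_def by (elim insertE) (simp_all add: sporadic_def)

lemma excB6_sporadic: "(g, a1, a2) \<in> excB6 \<Longrightarrow>
    \<exists>k\<in>{6,7,8,9,10}. g + a1 + a2 = k^2 + 2*k - 2 \<and> (k, g - 2*k + 1, a2 - k + 1) \<in> sporadic"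
  unfolding excB6_def by (elim insertE) (simp_all add: sporadic_def)

lemma excC2_shape: "(g, a1, a2) \<in> excC2 q \<Longrightarrow> g + a1 + a2 = q^2 + 2*q - 4 \<and>
    (a1 = q + 2 \<and> a2 = q + 1 \<or> g = 2*q + 1 \<and> (a2 = q + 1 \<or> a2 = q + 2))"
  by (auto simp: excC2_def)

lemma excC3_clash: "(g, a1, a2) \<in> excC3 q \<Longrightarrow>
    g + a1 + a2 = q^2 + 2*q - 3 \<and> ((a1 - q + 1, a2 - q + 1) \<in> clash 1 \<or>
      (g - 2*q + 1, a2 - q + 1) \<in> clash 1 \<or> (a2 - q + 1, g - 2*q + 1) \<in> clash 1) \<or>
    (g, a1, a2) \<in> {(22,16,7), (13,16,16)}"
  unfolding excC3_def by (elim insertE) (simp_all add: clash_def)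


section \<open>No cover in \<open>q\<close> rounds\<close>

lemma root_unique:
  fixes k q :: int
  assumes "0 \<le> k" "0 \<le> q" "k^2 < n" "n \<le> (k + 1)^2" "q^2 < n" "n \<le> (q + 1)^2"
  shows "q = k"
proof -
  have "q^2 < (k + 1)^2" "k^2 < (q + 1)^2" using assms by auto
  then have "q < k + 1" "k < q + 1" using assms(1,2) power2_less_imp_less by fastforce+
  then show ?thesis by simp
qed

text \<open>
  Counting gives \<open>r \<le> 2 * s\<close> and \<open>s + d \<le> q - 1\<close>.  Under the first five conditions the count
  already overflows.  For the exceptional triples it leaves so little room that only a few values of
  \<open>s\<close> and \<open>d\<close> are possible, and each of them determines the total lengths of the blocks spent on the
  legs up to a small excess.  Then one of these totals would have to be 2, or two of them are
  incompatible.
\<close>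
lemma no_fire_split:
  fixes g a1 a2 :: nat and q r :: int
  assumes n: "int g + int a1 + int a2 = q^2 + r"
    and "q \<ge> 1" and "1 \<le> r" and "r \<le> 2*q + 1"
    and conds: "r \<ge> 2*q - 1
      \<or> (3 \<le> g \<and> int g \<le> r)
      \<or> int g \<ge> q^2 + 1
      \<or> int a1 \<ge> q^2 - \<lfloor>real g / 2\<rfloor>
      \<or> (2*q \<le> int g \<and> int g \<le> q^2 \<and> int a2 \<le> r - q)
      \<or> (int g, int a1, int a2) \<in>
          excC1 q r \<union> excC2 q \<union> excC3 q \<union> excC4 q \<union> excC5 q \<union> excC6 q \<union> excB q"
    and split: "fire_split (nat q) (s + d) S"
    and g: "g - 1 \<le> 2 * s + (if p = (0::nat) then 2 * d else 0) + blocks (S 0)"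
    and a1: "a1 \<le> s + (if p = 1 then 2 * d else 0) + blocks (S 1)"
    and a2: "a2 \<le> s + (if p = 2 then 2 * d else 0) + blocks (S 2)"
  shows False
proof -
  define w0 w1 w2 where w: "w0 = int (blocks (S 0))" "w1 = int (blocks (S 1))" "w2 = int (blocks (S 2))"
  define d0 d1 d2 where d: "d0 = (if p = 0 then int d else 0)" "d1 = (if p = 1 then int d else 0)"
    "d2 = (if p = 2 then int d else 0)"
  have w_pos: "0 \<le> w0" "0 \<le> w1" "0 \<le> w2" by (simp_all add: w)
  have d_le: "0 \<le> d0" "0 \<le> d1" "0 \<le> d2" "d0 + d1 + d2 \<le> int d" by (auto simp: d)
  have x0: "int g - 1 \<le> 2 * int s + 2 * d0 + w0" using g unfolding d w by (auto split: if_splits)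
  have x1: "int a1 \<le> int s + 2 * d1 + w1" using a1 unfolding d w by (auto split: if_splits)
  have x2: "int a2 \<le> int s + 2 * d2 + w2" using a2 unfolding d w by (auto split: if_splits)
  have "int (blocks (S 0) + blocks (S 1) + blocks (S 2) + (2 * (s + d) + 1)) \<le> int ((nat q)^2)"
    using fire_split_total[OF split] by (simp only: of_nat_le_iff)
  then have total: "w0 + w1 + w2 + 2 * int s + 2 * int d + 1 \<le> q^2"
    using \<open>q \<ge> 1\<close> by (simp add: w)
  have sd: "int s + int d \<le> q - 1" using split \<open>q \<ge> 1\<close> by (auto simp: fire_split_def)
  have sub: "S j \<subseteq> {..<nat q}" for j using split by (auto simp: fire_split_def)
  then have fin: "finite (S j)" for j using finite_subset by blast
  have dis: "S i \<inter> S j = {}" if "i \<noteq> j" for i j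
    using split that by (auto simp: fire_split_def disjoint_family_on_def)
  note clash = clash_not_disjoint[OF fin fin dis]
  have not2: "w0 \<noteq> 2" "w1 \<noteq> 2" "w2 \<noteq> 2"
    using clash_not_disjoint[OF fin finite.emptyI Int_empty_right, of 2 0 0]
    by (auto simp: w clash_def)
  have r_le: "r \<le> 2 * int s" using x0 x1 x2 total n d_le by linarith
  have sub1: "S j \<subseteq> {..<nat q - 1}" if "s + d = nat q - 1" for j
    using split that \<open>q \<ge> 1\<close> unfolding fire_split_def by force
  \<comment> \<open>If \<open>r = 2 * q - 2\<close>, then the counting leaves no excess: the hub ball and the blocks tile.\<close>
  have tight: "int s = q - 1 \<and> d = 0 \<and> w0 = int g - 2*q + 1 \<and> w1 = int a1 - q + 1 \<and> w2 = int a2 - q + 1"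
    if "r = 2*q - 2"
  proof -
    have s: "int s = q - 1" and "d = 0" using that r_le sd by linarith+
    then have "d0 = 0" "d1 = 0" "d2 = 0" by (simp_all add: d)
    then show ?thesis using that s \<open>d = 0\<close> x0 x1 x2 total n by simp
  qed
  have rigid: False
    if k: "k \<in> {6,7,8,9,10}" "int g + int a1 + int a2 = k^2 + 2*k - 2"
      and ij: "i \<noteq> j" "q = k \<Longrightarrow> r = 2*q - 2 \<Longrightarrow> (k, int (blocks (S i)), int (blocks (S j))) \<in> sporadic"
    for k i j
  proof -
    have "q = k" using root_unique[of k q "int g + int a1 + int a2"] n k assms(2-4)
      by (auto simp: power2_eq_square algebra_simps)
    moreover have r: "r = 2*q - 2" using n k(2) \<open>q = k\<close> by simp
    moreover have "s + d = nat q - 1" using tight[OF r] by auto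
    ultimately show False
      using sporadic_not_packs[OF ij(2)] packs_of_disjoint[OF sub1 sub1 dis[OF ij(1)]] by simp
  qed
  have floor: "\<lfloor>real g / 2\<rfloor> = int (g div 2)" using floor_divide_of_nat_eq[of g 2] by simp
  show False
    using conds
  proof (elim disjE UnE)
    assume "r \<ge> 2*q - 1" then show False using r_le sd by linarith
  next
    assume "3 \<le> g \<and> int g \<le> r"
    then show False using x1 x2 total n d_le w_pos by linarith
  next
    assume "int g \<ge> q^2 + 1"
    then show False using x0 total d_le w_pos by linarith
  next
    assume "int a1 \<ge> q^2 - \<lfloor>real g / 2\<rfloor>"
    moreover have "2 * int (g div 2) \<le> int g" by linarith
    ultimately show False using x0 x1 total d_le w_pos unfolding floor by linarith
  next
    assume "2*q \<le> int g \<and> int g \<le> q^2 \<and> int a2 \<le> r - q"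
    then show False using x0 x1 total n d_le w_pos sd by linarith
  next
    assume C1: "(int g, int a1, int a2) \<in> excC1 q r"
    then have "int a2 = r - q + 1" by (auto simp: excC1_def)
    then have s: "int s = q - 1" and "d = 0" using x0 x1 total n d_le w_pos sd by linarith+
    then have "d0 = 0" "d1 = 0" by (simp_all add: d)
    from C1 have "int g = 2*q + 1 \<and> int a1 = q^2 - q - 2 \<or> int g = q^2 - 2 \<and> int a1 = q + 1"
      by (auto simp: excC1_def)
    then have "w0 = 2 \<or> w1 = 2"
    proof (elim disjE conjE)
      assume "int g = 2*q + 1" "int a1 = q^2 - q - 2"
      then have "w0 = 2" using s \<open>d = 0\<close> \<open>d0 = 0\<close> \<open>d1 = 0\<close> x0 x1 total w_pos by linarith
      then show ?thesis ..
    next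
      assume "int g = q^2 - 2" "int a1 = q + 1"
      then have "w1 = 2" using s \<open>d = 0\<close> \<open>d0 = 0\<close> \<open>d1 = 0\<close> x0 x1 total w_pos by linarith
      then show ?thesis ..
    qed
    then show False using not2 by simp
  next
    assume "(int g, int a1, int a2) \<in> excC2 q"
    from excC2_shape[OF this] have r: "r = 2*q - 4"
      and shape: "int a1 = q + 2 \<and> int a2 = q + 1 \<or> int g = 2*q + 1 \<and> (int a2 = q + 1 \<or> int a2 = q + 2)"
      using n by auto
    have pairs: "(3,2) \<in> clash 2" "(2,2) \<in> clash 2" "(4,3) \<in> clash 0" "(4,1) \<in> clash 0"
      "(4,4) \<in> clash 0"
      by (simp_all add: clash_def)
    \<comment> \<open>Either the largest ball is at the hub and the excess is at most 2, or there is no excess.\<close>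
    have "int s = q - 1 \<or> int s = q - 2" using r r_le sd by linarith
    then show False
    proof
      assume s: "int s = q - 1"
      then have "d = 0" using sd by simp
      then have "d0 = 0" "d1 = 0" "d2 = 0" by (simp_all add: d)
      then have slack: "int g - 2*q + 1 \<le> w0" "int a1 - q + 1 \<le> w1" "int a2 - q + 1 \<le> w2"
          "w0 + w1 + w2 \<le> (int g - 2*q + 1) + (int a1 - q + 1) + (int a2 - q + 1) + 2"
        using x0 x1 x2 n total r s \<open>d = 0\<close> by linarith+
      from shape show False
      proof (elim disjE conjE)
        assume "int a1 = q + 2" "int a2 = q + 1"
        then show False by (intro clash[OF _ pairs(1), of 1 2]) (use slack in \<open>auto simp: w\<close>)
      next
        assume "int g = 2*q + 1" "int a2 = q + 1"
        then show False by (intro clash[OF _ pairs(2), of 0 2]) (use slack in \<open>auto simp: w\<close>)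
      next
        assume "int g = 2*q + 1" "int a2 = q + 2"
        then show False by (intro clash[OF _ pairs(1), of 2 0]) (use slack in \<open>auto simp: w\<close>)
      qed
    next
      assume s: "int s = q - 2"
      have w_eq: "w0 = int g - 1 - 2 * int s - 2 * d0" "w1 = int a1 - int s - 2 * d1"
        "w2 = int a2 - int s - 2 * d2"
        using x0 x1 x2 s r n total d_le by linarith+
      have "(d0, d1, d2) \<in> {(0,0,0), (1,0,0), (0,1,0), (0,0,1)}"
        using s sd by (auto simp: d)
      with shape w_eq s have "w0 = 2 \<or> w1 = 2 \<or> w2 = 2 \<or> w1 = 4 \<and> w2 = 3 \<or> w1 = 4 \<and> w2 = 1 \<or>
          w0 = 4 \<and> w2 = 3 \<or> w0 = 4 \<and> w2 = 1 \<or> w0 = 4 \<and> w2 = 4"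
        by (elim disjE conjE insertE) (simp_all add: algebra_simps)
      then show False
      proof (elim disjE conjE)
        assume "w1 = 4" "w2 = 3"
        then show False by (intro clash[OF _ pairs(3), of 1 2]) (auto simp: w)
      next
        assume "w1 = 4" "w2 = 1"
        then show False by (intro clash[OF _ pairs(4), of 1 2]) (auto simp: w)
      next
        assume "w0 = 4" "w2 = 3"
        then show False by (intro clash[OF _ pairs(3), of 0 2]) (auto simp: w)
      next
        assume "w0 = 4" "w2 = 1"
        then show False by (intro clash[OF _ pairs(4), of 0 2]) (auto simp: w)
      next
        assume "w0 = 4" "w2 = 4"
        then show False by (intro clash[OF _ pairs(5), of 0 2]) (auto simp: w)
      qed (use not2 in simp_all)
    qed
  next
    assume "(int g, int a1, int a2) \<in> excC3 q"
    from excC3_clash[OF this]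
    have shape: "r = 2*q - 3 \<and> ((int a1 - q + 1, int a2 - q + 1) \<in> clash 1 \<or>
        (int g - 2*q + 1, int a2 - q + 1) \<in> clash 1 \<or> (int a2 - q + 1, int g - 2*q + 1) \<in> clash 1) \<or>
        int g + int a1 + int a2 = 45 \<and> (g, a1, a2) \<in> {(22,16,7), (13,16,16)}"
      using n by auto
    have q: "q = 6" if "int g + int a1 + int a2 = 45"
      using root_unique[of 6 q 45] n that assms(2-4) by (simp add: power2_eq_square algebra_simps)
    then have r: "r = 2*q - 3" using shape n by auto
    have s: "int s = q - 1" and "d = 0" using r r_le sd by linarith+
    then have "d0 = 0" "d1 = 0" "d2 = 0" by (simp_all add: d)
    then have slack: "int g - 2*q + 1 \<le> w0" "int a1 - q + 1 \<le> w1" "int a2 - q + 1 \<le> w2"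
        "w0 + w1 + w2 \<le> (int g - 2*q + 1) + (int a1 - q + 1) + (int a2 - q + 1) + 1"
      using x0 x1 x2 n total r s \<open>d = 0\<close> by linarith+
    from shape show False
    proof (elim disjE conjE)
      assume "(int a1 - q + 1, int a2 - q + 1) \<in> clash 1"
      then show False by (rule clash[rotated, of _ _ 1 1 2]) (use slack w_pos in \<open>auto simp: w\<close>)
    next
      assume "(int g - 2*q + 1, int a2 - q + 1) \<in> clash 1"
      then show False by (rule clash[rotated, of _ _ 1 0 2]) (use slack w_pos in \<open>auto simp: w\<close>)
    next
      assume "(int a2 - q + 1, int g - 2*q + 1) \<in> clash 1"
      then show False by (rule clash[rotated, of _ _ 1 2 0]) (use slack w_pos in \<open>auto simp: w\<close>)
    next
      assume n: "int g + int a1 + int a2 = 45" and triple: "(g, a1, a2) \<in> {(22,16,7), (13,16,16)}"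
      have "s + d = nat q - 1" using s \<open>d = 0\<close> by auto
      then have packed: "packs (odds 5) (blocks (S i)) (blocks (S j))" if "i \<noteq> j" for i j
        using packs_of_disjoint[OF sub1 sub1 dis[OF that]] q[OF n] by simp
      have no: "\<not> packs (odds 5) 3 11"
        by (simp add: odds_5 packs.simps)
      have "w2 = 3 \<and> w1 = 11 \<or> w0 = 3 \<and> w1 = 11"
        using triple slack q[OF n] not2 by auto
      then show False using packed[of 2 1] packed[of 0 1] no by (auto simp: w)
    qed
  next
    assume "(int g, int a1, int a2) \<in> excC4 q"
    then show False unfolding excC4_def
    proof (elim UnE)
      assume "(int g, int a1, int a2) \<in> {(g, a1, a2). g + a1 + a2 = q^2+2*q-2 \<and> g - q \<ge> a1 \<and> a1 \<ge> a2 \<and> a2 = q+1}"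
      then show False using tight not2 n by auto
    next
      assume "(int g, int a1, int a2) \<in> excB1 q"
      from excB1_clash[OF this] show False using tight n by (auto intro: clash[rotated, of _ _ 0 1 2] simp: w)
    next
      assume "(int g, int a1, int a2) \<in> excB4"
      from excB4_sporadic[OF this] obtain k where k: "k \<in> {6,7,8,9,10}"
        "int g + int a1 + int a2 = k^2 + 2*k - 2" "(k, int a2 - k + 1, int a1 - k + 1) \<in> sporadic" by blast
      show False by (rule rigid[OF k(1,2), of 2 1]) (use k(3) tight in \<open>simp_all add: w\<close>)
    qed
  next
    assume "(int g, int a1, int a2) \<in> excC5 q"
    then show False unfolding excC5_def
    proof (elim UnE)
      assume "(int g, int a1, int a2) \<in> {(g, a1, a2). g + a1 + a2 = q^2+2*q-2 \<and> a1 \<ge> g - q \<and> g - q \<ge> a2 \<and> a2 = q+1}"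
      then show False using tight not2 n by auto
    next
      assume "(int g, int a1, int a2) \<in> excB2 q"
      from excB2_clash[OF this] show False using tight n by (auto intro: clash[rotated, of _ _ 0 0 2] simp: w)
    next
      assume "(int g, int a1, int a2) \<in> excB5"
      from excB5_sporadic[OF this] obtain k where k: "k \<in> {6,7,8,9,10}"
        "int g + int a1 + int a2 = k^2 + 2*k - 2" "(k, int a2 - k + 1, int g - 2*k + 1) \<in> sporadic" by blast
      show False by (rule rigid[OF k(1,2), of 2 0]) (use k(3) tight in \<open>simp_all add: w\<close>)
    qed
  next
    assume "(int g, int a1, int a2) \<in> excC6 q"
    then show False unfolding excC6_def
    proof (elim UnE)
      assume "(int g, int a1, int a2) \<in> {(g, a1, a2). g + a1 + a2 = q^2+2*q-2 \<and> a1 \<ge> a2 \<and> a2 \<ge> g - q \<and> g - q = q+1}"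
      then show False using tight not2 n by auto
    next
      assume "(int g, int a1, int a2) \<in> excB3 q"
      from excB3_clash[OF this] show False using tight n by (auto intro: clash[rotated, of _ _ 0 2 0] simp: w)
    next
      assume "(int g, int a1, int a2) \<in> excB6"
      from excB6_sporadic[OF this] obtain k where k: "k \<in> {6,7,8,9,10}"
        "int g + int a1 + int a2 = k^2 + 2*k - 2" "(k, int g - 2*k + 1, int a2 - k + 1) \<in> sporadic" by blast
      show False by (rule rigid[OF k(1,2), of 0 2]) (use k(3) tight in \<open>simp_all add: w\<close>)
    qed
  next
    assume B: "(int g, int a1, int a2) \<in> excB q"
    then consider "r = 2*q - 2" "int a2 = q + 1"
      | "r = 2*q - 3" "int a1 = q^2 - q - 2" "int a2 = q + 1"
      using n by (auto simp: excB_def)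
    then show False
    proof cases
      case 1
      then show ?thesis using tight not2 by simp
    next
      case 2
      then have s: "int s = q - 1" and "d = 0" using r_le sd by linarith+
      then have "d1 = 0" "d2 = 0" by (simp_all add: d)
      then have "w2 = 2" using 2 s \<open>d = 0\<close> x1 x2 total w_pos by simp
      then show ?thesis using not2 by simp
    qed
  qed
qed


section \<open>The burning number\<close>

theorem theorem4p10:
  fixes g a1 a2 n :: nat and q r :: int
  assumes "g \<ge> 3" and "a1 \<ge> a2" and "a2 \<ge> 1"
    and "n = g + a1 + a2" and "int n = q^2 + r"
    and "q \<ge> 1" and "1 \<le> r" and "r \<le> 2*q + 1"
    and "r \<ge> 2*q - 1
      \<or> (3 \<le> g \<and> int g \<le> r)
      \<or> int g \<ge> q^2 + 1
      \<or> int a1 \<ge> q^2 - \<lfloor>real g / 2\<rfloor>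
      \<or> (2*q \<le> int g \<and> int g \<le> q^2 \<and> int a2 \<le> r - q)
      \<or> (int g, int a1, int a2) \<in>
          excC1 q r \<union> excC2 q \<union> excC3 q \<union> excC4 q \<union> excC5 q \<union> excC6 q \<union> excB q"
  shows "int (burning_number (unicyclic2 g a1 a2)) = \<lceil>sqrt (real n)\<rceil> \<and> \<lceil>sqrt (real n)\<rceil> = q + 1"
proof -
  let ?G = "unicyclic2 g a1 a2" and ?k = "nat q"
  have a1: "1 \<le> a1" using assms(2,3) by simp
  have lower: "q^2 < int n" and upper: "int n \<le> (q + 1)^2"
    using assms(5,7,8) by (simp_all add: power2_eq_square algebra_simps)
  have "real_of_int (q^2) < real n" "real n \<le> real_of_int ((q + 1)^2)"
    using lower upper by linarith+
  then have "real_of_int q < sqrt (real n)" "sqrt (real n) \<le> real_of_int (q + 1)"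
    using assms(6) by (auto intro!: real_less_rsqrt real_le_lsqrt)
  then have ceil: "\<lceil>sqrt (real n)\<rceil> = q + 1" by (intro ceiling_unique) auto
  have "int (leg_length g a1 a2 0 + leg_length g a1 a2 1 + leg_length g a1 a2 2) < int ((Suc ?k)^2)"
    using upper assms(1,4,6) by (simp add: leg_length_def add.commute)
  then have "spider_split (Suc ?k) (leg_length g a1 a2)"
    by (intro spider_split_exists) linarith
  then have burns: "burnable_within ?G (Suc ?k)"
    using burnable_of_spider_split[OF assms(1) a1 assms(3)] by blast
  have slow: "\<not> burnable_within ?G k" if "k \<le> ?k" for k
  proof
    assume "burnable_within ?G k"
    then obtain s d p S where "fire_split k (s + d) S"
      and *: "g - 1 \<le> 2 * s + (if p = (0::nat) then 2 * d else 0) + blocks (S 0)"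
        "a1 \<le> s + (if p = 1 then 2 * d else 0) + blocks (S 1)"
        "a2 \<le> s + (if p = 2 then 2 * d else 0) + blocks (S 2)"
      using fire_split_of_burnable[OF assms(1) a1 assms(3)] by blast
    then have "fire_split ?k (s + d) S" using that unfolding fire_split_def by fastforce
    moreover have "int g + int a1 + int a2 = q^2 + r" using assms(4,5) by simp
    ultimately show False
      using no_fire_split[OF _ assms(6-9) _ *] by blast
  qed
  have "burning_number ?G = Suc ?k"
    unfolding burning_number_def
    using burns slow by (intro Least_equality) (auto simp: not_less_eq_eq[symmetric])
  then show ?thesis using ceil assms(6) by simp
qed

end
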